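(* Let $m_j\to\infty$ be a sequence along which $u^{(m_j)}\to u^{(\infty)}$ and $m_j(u^{(m_j)}-1)_+\to V$ in the weak-$*$ topology of $L^\infty(D^c\times(0,\infty))$. Then $$0\le V\le M ,$$ and the pair $(u^{(\infty)},V)$ satisfies, for every test function $\varphi$ of the class described in the context, $$\int_{D^c}\int_0^\infty \varphi_t(x,t)\,u^{(\infty)}(x,t)\,dt\,dx+\int_{D^c}\int_0^\infty \Delta_x\varphi(x,t)\,V(x,t)\,dt\,dx=\int_{\partial D}\int_0^\infty\frac{\partial\varphi}{\partial\nu}(x,t)\,p(x)\,dt\,d\mathcal H^{n-1}x-\int_{D^c}\varphi(x,0)\,u_I(x)\,dx .$$
   Context: $D\subset\mathbb R^n$ is a bounded open set (not necessarily connected) with $\partial D\in C^{2,\alpha}$, $0<\alpha<1$, and $D^c=\mathbb R^n\setminus D$. The initial datum $u_I:D^c\to[0,1]$ is measurable with compact support; the boundary datum $p\in C^{2,\alpha}(\partial D)$ satisfies $p>0$. Put $M=\|p\|_{L^\infty(\partial D)}$ and $s_+=\max(s,0)$. Test functions: $\varphi\in C^\infty(\mathbb R^n\times[0,\infty))$ with $\varphi\equiv0$ on $\partial D\times[0,\infty)$ and $\varphi(x,t)\to0$ as either $t\to\infty$ or $|x|\to\infty$, such that the integrals in the identities converge absolutely. $\nu$ is the unit normal on $\partial D$ exterior to $D^c$. For $m>0$, $u^{(m)}$ denotes the weak solution of the $m$-approximating problem, i.e. the nonnegative function $u^{(m)}\in L^1_{loc}$ such that for all test functions $$\int_{D^c}\int_0^\infty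 \varphi_t\,u^{(m)}\,dt\,dx+\int_{D^c}\int_0^\infty \Delta_x\varphi\; m(u^{(m)}-1)_+\,dt\,dx=\int_{\partial D}\int_0^\infty\frac{\partial\varphi}{\partial\nu}\,p(x)\,dt\,d\mathcal H^{n-1}x-\int_{D^c}\varphi(x,0)u_I(x)\,dx .$$ One has $0\le u^{(m)}\le 1+M/m$, so weak-$*$ subsequential limits exist. *)

theory Defs
  imports "HOL-Analysis.Analysis" "HOL-Probability.Essential_Supremum"
begin

section \<open>Differentiability classes and differential operators\<close>

text \<open>
  Differentiability is taken within \<open>S\<close>, so on \<open>UNIV \<times> {0..}\<close> the derivatives at time 0 are
  one-sided: this is smoothness up to and including the initial time.
\<close>

primrec C_on :: "nat \<Rightarrow> 'a::euclidean_space set \<Rightarrow> ('a \<Rightarrow> real) \<Rightarrow> bool" where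
  "C_on 0 S f \<longleftrightarrow> continuous_on S f"
| "C_on (Suc k) S f \<longleftrightarrow>
     (\<exists>g. (\<forall>x\<in>S. (f has_derivative (\<lambda>h. g x \<bullet> h)) (at x within S)) \<and>
          (\<forall>b\<in>Basis. C_on k S (\<lambda>x. g x \<bullet> b)))"

definition smooth_on :: "'a::euclidean_space set \<Rightarrow> ('a \<Rightarrow> real) \<Rightarrow> bool" where
  "smooth_on S f \<longleftrightarrow> (\<forall>k. C_on k S f)"

definition dir_deriv :: "'a::euclidean_space \<Rightarrow> ('a \<Rightarrow> real) \<Rightarrow> 'a \<Rightarrow> real" where
  "dir_deriv v f x = deriv (\<lambda>s. f (x + s *\<^sub>R v)) 0"

definition laplacian :: "('a::euclidean_space \<Rightarrow> real) \<Rightarrow> 'a \<Rightarrow> real" where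
  "laplacian f x = (\<Sum>b\<in>Basis. dir_deriv b (dir_deriv b f) x)"

definition C2_holder :: "real \<Rightarrow> ('a::euclidean_space \<Rightarrow> real) \<Rightarrow> bool" where
  "C2_holder \<alpha> f \<longleftrightarrow> C_on 2 UNIV f \<and>
     (\<exists>C. \<forall>b\<in>Basis. \<forall>c\<in>Basis. \<forall>x y.
        \<bar>dir_deriv b (dir_deriv c f) x - dir_deriv b (dir_deriv c f) y\<bar> \<le> C * dist x y powr \<alpha>)"

section \<open>Domains with boundary of class $C^{2,\alpha}$\<close>

text \<open>
  Near \<open>x0\<close> the set \<open>D\<close> is the strict epigraph, in the direction of the unit vector \<open>e\<close>, of a
  function on the hyperplane orthogonal to \<open>e\<close>.  Functions on that hyperplane are represented by
  functions on the whole space that are only evaluated at \<open>hyp_proj e x\<close>.  That they are defined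
  and Hoelder globally is no restriction, since only their values near the projection of \<open>x0\<close>
  matter.
\<close>

definition hyp_proj :: "'a::euclidean_space \<Rightarrow> 'a \<Rightarrow> 'a" where
  "hyp_proj e x = x - (x \<bullet> e) *\<^sub>R e"

definition graph_chart ::
    "real \<Rightarrow> 'a::euclidean_space set \<Rightarrow> 'a \<Rightarrow> real \<Rightarrow> 'a \<Rightarrow> ('a \<Rightarrow> real) \<Rightarrow> bool" where
  "graph_chart \<alpha> D x0 r e \<gamma> \<longleftrightarrow> 0 < r \<and> norm e = 1 \<and> C2_holder \<alpha> \<gamma> \<and>
     D \<inter> ball x0 r = {x \<in> ball x0 r. \<gamma> (hyp_proj e x) < x \<bullet> e}"

definition C2_holder_boundary :: "real \<Rightarrow> 'a::euclidean_space set \<Rightarrow> bool" where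
  "C2_holder_boundary \<alpha> D \<longleftrightarrow> (\<forall>x0\<in>frontier D. \<exists>r e \<gamma>. graph_chart \<alpha> D x0 r e \<gamma>)"

text \<open>
  Here \<open>q\<close> is \<open>p\<close> in the local coordinates of the graph.
\<close>

definition C2_holder_on_boundary ::
    "real \<Rightarrow> 'a::euclidean_space set \<Rightarrow> ('a \<Rightarrow> real) \<Rightarrow> bool" where
  "C2_holder_on_boundary \<alpha> D p \<longleftrightarrow>
     (\<forall>x0\<in>frontier D. \<exists>r e \<gamma> q. graph_chart \<alpha> D x0 r e \<gamma> \<and> C2_holder \<alpha> q \<and>
        (\<forall>x\<in>frontier D \<inter> ball x0 r. p x = q (hyp_proj e x)))"

text \<open>
  \<open>v\<close> is orthogonal to the tangent directions of the frontier at \<open>x\<close> and leaves \<open>A\<close>.  In the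
  application \<open>A\<close> is the complement of the domain \<open>D\<close>, so \<open>v\<close> points into \<open>D\<close>.
\<close>

definition exterior_unit_normal :: "'a::euclidean_space set \<Rightarrow> 'a \<Rightarrow> 'a \<Rightarrow> bool" where
  "exterior_unit_normal A x v \<longleftrightarrow> norm v = 1 \<and>
     ((\<lambda>y. ((y - x) \<bullet> v) / norm (y - x)) \<longlongrightarrow> 0) (at x within frontier A) \<and>
     (\<forall>\<^sub>F s in at_right 0. x + s *\<^sub>R v \<notin> A \<and> x - s *\<^sub>R v \<in> A)"

section \<open>Hausdorff measure\<close>

text \<open>
  The normalisation makes the measure agree with surface area.  Covering sets are required to be
  bounded because \<^const>\<open>diameter\<close> is meaningless on unbounded sets; \<open>0 ^ 0 = 1\<close>
  makes the case \<open>k = 0\<close> the counting measure.  The outer measure is a metric outer measure,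
  hence countably additive on the Borel sets, so \<^const>\<open>measure_of\<close> does not degenerate to 0.
\<close>

definition hausdorff_content :: "nat \<Rightarrow> real \<Rightarrow> 'a::metric_space set \<Rightarrow> ennreal" where
  "hausdorff_content k \<delta> A =
     (INF U\<in>{U :: nat \<Rightarrow> 'a set. A \<subseteq> (\<Union>i. U i) \<and> (\<forall>i. bounded (U i) \<and> diameter (U i) \<le> \<delta>)}.
        \<Sum>i. if U i = {} then 0 else ennreal (unit_ball_vol (real k) * (diameter (U i) / 2) ^ k))"

definition hausdorff_outer :: "nat \<Rightarrow> 'a::metric_space set \<Rightarrow> ennreal" where
  "hausdorff_outer k A = (SUP \<delta>\<in>{0<..}. hausdorff_content k \<delta> A)"

definition hausdorff_measure :: "nat \<Rightarrow> 'a::metric_space measure" where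
  "hausdorff_measure k = measure_of UNIV (sets borel) (hausdorff_outer k)"

definition boundary_measure :: "'a::euclidean_space set \<Rightarrow> 'a measure" where
  "boundary_measure D = restrict_space (hausdorff_measure (DIM('a) - 1)) (frontier D)"

section \<open>Function spaces\<close>

definition Linf :: "'a measure \<Rightarrow> ('a \<Rightarrow> real) \<Rightarrow> bool" where
  "Linf N f \<longleftrightarrow> f \<in> borel_measurable N \<and> (\<exists>C. AE x in N. \<bar>f x\<bar> \<le> C)"

definition Linf_norm :: "'a measure \<Rightarrow> ('a \<Rightarrow> real) \<Rightarrow> real" where
  "Linf_norm N f = real_of_ereal (esssup N (\<lambda>x. ereal \<bar>f x\<bar>))"

definition weak_star_tendsto ::
    "'a measure \<Rightarrow> (nat \<Rightarrow> 'a \<Rightarrow> real) \<Rightarrow> ('a \<Rightarrow> real) \<Rightarrow> bool" where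
  "weak_star_tendsto N F f \<longleftrightarrow> (\<forall>j. Linf N (F j)) \<and> Linf N f \<and>
     (\<forall>g::'a \<Rightarrow> real. integrable N g \<longrightarrow>
        (\<lambda>j. LINT z|N. F j z * g z) \<longlonglongrightarrow> (LINT z|N. f z * g z))"

definition locally_integrable_on ::
    "'a::euclidean_space set \<Rightarrow> ('a \<Rightarrow> real) \<Rightarrow> bool" where
  "locally_integrable_on S f \<longleftrightarrow>
     (\<forall>K. compact K \<and> K \<subseteq> S \<longrightarrow> integrable (lebesgue_on K) f)"

section \<open>The approximating problems\<close>

abbreviation spacetime :: "'a::euclidean_space set \<Rightarrow> ('a \<times> real) measure" where
  "spacetime D \<equiv> lebesgue_on ((- D) \<times> {0<..})"

definition t_deriv :: "('a \<times> real \<Rightarrow> real) \<Rightarrow> 'a \<times> real \<Rightarrow> real" where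
  "t_deriv \<phi> = (\<lambda>(x, t). deriv (\<lambda>s. \<phi> (x, s)) t)"

definition x_laplacian :: "('a::euclidean_space \<times> real \<Rightarrow> real) \<Rightarrow> 'a \<times> real \<Rightarrow> real" where
  "x_laplacian \<phi> = (\<lambda>(x, t). laplacian (\<lambda>y. \<phi> (y, t)) x)"

definition normal_deriv ::
    "('a::euclidean_space \<Rightarrow> 'a) \<Rightarrow> ('a \<times> real \<Rightarrow> real) \<Rightarrow> 'a \<times> real \<Rightarrow> real" where
  "normal_deriv \<nu> \<phi> = (\<lambda>(x, t). dir_deriv (\<nu> x) (\<lambda>y. \<phi> (y, t)) x)"

text \<open>
  Absolute convergence of the integrals in the weak formulation is imposed independently of the
  particular solution.  Solutions are bounded but otherwise arbitrary, so it amounts to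
  integrability of the time derivative and of the Laplacian.
\<close>

definition test_function ::
    "'a::euclidean_space set \<Rightarrow> ('a \<Rightarrow> 'a) \<Rightarrow> ('a \<Rightarrow> real) \<Rightarrow> ('a \<Rightarrow> real) \<Rightarrow>
     ('a \<times> real \<Rightarrow> real) \<Rightarrow> bool" where
  "test_function D \<nu> p u_I \<phi> \<longleftrightarrow>
     smooth_on (UNIV \<times> {0..}) \<phi> \<and>
     (\<forall>x\<in>frontier D. \<forall>t\<ge>0. \<phi> (x, t) = 0) \<and>
     (\<forall>x. ((\<lambda>t. \<phi> (x, t)) \<longlongrightarrow> 0) at_top) \<and>
     (\<forall>t\<ge>0. ((\<lambda>x. \<phi> (x, t)) \<longlongrightarrow> 0) at_infinity) \<and>
     integrable (spacetime D) (t_deriv \<phi>) \<and>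
     integrable (spacetime D) (x_laplacian \<phi>) \<and>
     integrable (boundary_measure D \<Otimes>\<^sub>M lebesgue_on {0<..})
       (\<lambda>(x, t). normal_deriv \<nu> \<phi> (x, t) * p x) \<and>
     integrable (lebesgue_on (- D)) (\<lambda>x. \<phi> (x, 0) * u_I x)"

text \<open>
  The first two conjuncts exclude that a divergent integral is silently read as 0; for the
  right-hand side this is part of \<^const>\<open>test_function\<close>.
\<close>

definition weak_identity ::
    "'a::euclidean_space set \<Rightarrow> ('a \<Rightarrow> 'a) \<Rightarrow> ('a \<Rightarrow> real) \<Rightarrow> ('a \<Rightarrow> real) \<Rightarrow>
     ('a \<times> real \<Rightarrow> real) \<Rightarrow> ('a \<times> real \<Rightarrow> real) \<Rightarrow> ('a \<times> real \<Rightarrow> real) \<Rightarrow> bool" where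
  "weak_identity D \<nu> p u_I \<phi> u w \<longleftrightarrow>
     integrable (spacetime D) (\<lambda>z. t_deriv \<phi> z * u z) \<and>
     integrable (spacetime D) (\<lambda>z. x_laplacian \<phi> z * w z) \<and>
     (LINT x|lebesgue_on (- D). LINT t|lebesgue_on {0<..}. t_deriv \<phi> (x, t) * u (x, t)) +
     (LINT x|lebesgue_on (- D). LINT t|lebesgue_on {0<..}. x_laplacian \<phi> (x, t) * w (x, t)) =
     (LINT x|boundary_measure D. LINT t|lebesgue_on {0<..}. normal_deriv \<nu> \<phi> (x, t) * p x) -
     (LINT x|lebesgue_on (- D). \<phi> (x, 0) * u_I x)"

definition pressure :: "real \<Rightarrow> ('b \<Rightarrow> real) \<Rightarrow> 'b \<Rightarrow> real" where
  "pressure m u z = m * max (u z - 1) 0"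

definition weak_solution ::
    "'a::euclidean_space set \<Rightarrow> ('a \<Rightarrow> 'a) \<Rightarrow> ('a \<Rightarrow> real) \<Rightarrow> ('a \<Rightarrow> real) \<Rightarrow>
     real \<Rightarrow> ('a \<times> real \<Rightarrow> real) \<Rightarrow> bool" where
  "weak_solution D \<nu> p u_I m u \<longleftrightarrow>
     locally_integrable_on ((- D) \<times> {0..}) u \<and>
     (AE z in spacetime D. 0 \<le> u z) \<and>
     (\<forall>\<phi>. test_function D \<nu> p u_I \<phi> \<longrightarrow> weak_identity D \<nu> p u_I \<phi> u (pressure m u))"

end

theory Submission
  imports Defs
begin

text \<open>
  For a fixed test function \<open>\<phi>\<close> the left-hand side of the weak identity is linear in the pair
  formed by the solution and its pressure, which are multiplied by \<open>t_deriv \<phi>\<close> and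
  \<open>x_laplacian \<phi>\<close>; the right-hand side is independent of this pair.  The two derivatives are
  integrable over space-time, so they are admissible dual elements for weak-\<open>*\<close> convergence in
  \<open>L\<^sup>\<infinity>\<close>, and both terms on the left converge separately.  The pressure is a nonlinear function
  of the solution, and weak limits do not respect such functions.  This is harmless because \<open>V\<close> is
  not claimed to be a function of \<open>u_inf\<close>.

  Weak-\<open>*\<close> convergence concerns integrals over space-time, whereas the identity is stated with
  iterated integrals.  The passage between the two is Fubini's theorem for the completed Lebesgue
  measure (\<open>lebesgue_on_Fubini\<close>).

  For the bounds on \<open>V\<close>, let \<open>M\<close> be \<open>Linf_norm (boundary_measure D) p\<close>.  The a priori estimate
  \<open>u \<le> 1 + M / m\<close> gives
  \<open>0 \<le> m (u - 1)\<^sub>+ \<le> M\<close> uniformly in \<open>m\<close>, and one-sided bounds that hold almost everywhere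
  survive weak-\<open>*\<close> limits (\<open>weak_star_limit_AE_ge\<close>).
\<close>

lemma integrable_mult_Linf:
  assumes f: "Linf N f" and g: "integrable N g"
  shows "integrable N (\<lambda>z. f z * g z)"
proof -
  obtain C where C: "AE z in N. \<bar>f z\<bar> \<le> C" and [measurable]: "f \<in> borel_measurable N"
    using f by (auto simp: Linf_def)
  have [measurable]: "g \<in> borel_measurable N" using g by auto
  have "integrable N (\<lambda>z. C * g z)" using g by simp
  then show ?thesis
  proof (rule Bochner_Integration.integrable_bound)
    show "(\<lambda>z. f z * g z) \<in> borel_measurable N" by measurable
    show "AE z in N. norm (f z * g z) \<le> norm (C * g z)"
      using C
    proof eventually_elim
      case (elim z)
      then have "\<bar>f z\<bar> \<le> \<bar>C\<bar>" by linarith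
      then show ?case by (simp add: abs_mult mult_right_mono)
    qed
  qed
qed

text \<open>
  The indicator of a subset of finite measure of \<open>{f < c}\<close> is a dual element.  On
  such a subset the integral of \<open>f - c\<close> is a limit of nonnegative numbers, although its integrand
  is negative; hence the subset is null.
\<close>

lemma weak_star_limit_AE_ge:
  assumes "sigma_finite_measure N"
    and lim: "weak_star_tendsto N F f"
    and ge: "\<And>j. AE z in N. c \<le> F j z"
  shows "AE z in N. c \<le> f z"
proof -
  interpret sigma_finite_measure N by fact
  obtain A :: "nat \<Rightarrow> 'a set" where A: "range A \<subseteq> sets N" "(\<Union>i. A i) = space N"
    "\<And>i. emeasure N (A i) \<noteq> \<infinity>"
    using sigma_finite by blast
  have f: "Linf N f" and F: "\<And>j. Linf N (F j)"
    using lim by (auto simp: weak_star_tendsto_def)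
  have [measurable]: "f \<in> borel_measurable N" using f by (simp add: Linf_def)
  have "AE z in N. z \<in> A i \<longrightarrow> c \<le> f z" for i
  proof -
    define B where "B = {z \<in> space N. z \<in> A i \<and> f z < c}"
    have [measurable]: "A i \<in> sets N" using A(1) by auto
    have [measurable]: "B \<in> sets N" unfolding B_def by measurable
    have "emeasure N B \<le> emeasure N (A i)" by (rule emeasure_mono) (auto simp: B_def)
    then have "emeasure N B < \<infinity>"
      using A(3)[of i] by (auto simp: less_top[symmetric] top_unique)
    then have g: "integrable N (indicator B :: _ \<Rightarrow> real)" by simp
    have fg: "integrable N (\<lambda>z. f z * indicator B z)" by (rule integrable_mult_Linf[OF f g])
    have cg: "integrable N (\<lambda>z. c * indicator B z)" using g by simp
    have "(LINT z|N. c * indicator B z) \<le> (LINT z|N. F j z * indicator B z)" for j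
      using ge[of j] by (intro integral_mono_AE cg integrable_mult_Linf[OF F g])
        (auto elim!: eventually_mono simp: indicator_def)
    moreover have "(\<lambda>j. LINT z|N. F j z * indicator B z) \<longlonglongrightarrow> (LINT z|N. f z * indicator B z)"
      using lim g by (simp add: weak_star_tendsto_def)
    ultimately have "(LINT z|N. c * indicator B z) \<le> (LINT z|N. f z * indicator B z)"
      by (intro LIMSEQ_le_const) auto
    then have le: "(LINT z|N. c * indicator B z - f z * indicator B z) \<le> 0"
      using fg cg by simp
    have nn: "AE z in N. 0 \<le> c * indicator B z - f z * indicator B z"
      by (auto simp: B_def indicator_def)
    have int: "integrable N (\<lambda>z. c * indicator B z - f z * indicator B z)"
      using fg cg by simp
    have "(LINT z|N. c * indicator B z - f z * indicator B z) = 0"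
      using le integral_nonneg_AE[OF nn] by linarith
    then have "AE z in N. c * indicator B z - f z * indicator B z = 0"
      using integral_nonneg_eq_0_iff_AE[OF int nn] by simp
    then show ?thesis
      using AE_space by eventually_elim (auto simp: B_def indicator_def split: if_splits)
  qed
  then have "AE z in N. \<forall>i. z \<in> A i \<longrightarrow> c \<le> f z"
    by (intro iffD2[OF AE_all_countable] allI)
  then show ?thesis
    using AE_space by eventually_elim (use A(2) in blast)
qed

lemma weak_star_tendsto_uminus:
  assumes "weak_star_tendsto N F f"
  shows "weak_star_tendsto N (\<lambda>j z. - F j z) (\<lambda>z. - f z)"
  using assms by (auto simp: weak_star_tendsto_def Linf_def intro: tendsto_minus)

lemma weak_star_limit_AE_le:
  assumes "sigma_finite_measure N"
    and "weak_star_tendsto N F f"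
    and "\<And>j. AE z in N. F j z \<le> c"
  shows "AE z in N. f z \<le> c"
  using weak_star_limit_AE_ge[OF assms(1) weak_star_tendsto_uminus[OF assms(2)], of "- c"] assms(3)
  by simp

lemma sigma_finite_lebesgue_on:
  assumes "S \<in> sets lebesgue"
  shows "sigma_finite_measure (lebesgue_on S)"
proof (rule sigma_finite_measure_restrict_space[OF _ assms])
  show "sigma_finite_measure (lebesgue :: 'a measure)"
  proof
    obtain A :: "'a set set" where A: "countable A" "A \<subseteq> sets lborel" "\<Union> A = space lborel"
      "\<forall>a\<in>A. emeasure lborel a \<noteq> \<infinity>"
      using lborel.sigma_finite_countable by blast
    moreover have "emeasure lebesgue a = emeasure lborel a" if "a \<in> A" for a
      using that A(2) by (auto intro!: emeasure_completion)
    ultimately show "\<exists>A::'a set set. countable A \<and> A \<subseteq> sets lebesgue \<and>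
      \<Union> A = space lebesgue \<and> (\<forall>a\<in>A. emeasure lebesgue a \<noteq> \<infinity>)"
      by (intro exI[of _ A]) auto
  qed
qed

text \<open>
  A Lebesgue measurable function on a product need not be measurable for the product of the
  Lebesgue \<sigma>-algebras, so the product Fubini theorem does not apply to it.  It agrees almost
  everywhere with a Borel function \<open>g\<close>, and Lebesgue-Borel measure on the product is a product
  measure; almost every section of \<open>f\<close> then agrees almost everywhere with that of \<open>g\<close>.
\<close>

lemma lebesgue_Fubini:
  fixes f :: "'a::euclidean_space \<times> 'b::euclidean_space \<Rightarrow> real"
  assumes f: "integrable lebesgue f"
  shows "(LINT x|lebesgue. LINT y|lebesgue. f (x, y)) = integral\<^sup>L lebesgue f"
proof -
  have "f \<in> borel_measurable lebesgue" using f by auto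
  then obtain g where g[measurable]: "g \<in> borel_measurable lborel"
    and fg: "AE z in lborel. f z = g z"
    using completion_ex_borel_measurable_real[of f lborel] by blast
  have gl: "g \<in> borel_measurable lebesgue" using g by (rule measurable_completion)
  have "integrable lebesgue g"
    using f integrable_cong_AE[OF _ gl AE_completion[OF fg]] by auto
  then have "integrable (lborel :: ('a \<times> 'b) measure) g"
    using integrable_completion[OF g] by simp
  then have gint: "integrable (lborel \<Otimes>\<^sub>M lborel) g" by (simp add: lborel_prod)
  have "AE z in (lborel :: 'a measure) \<Otimes>\<^sub>M (lborel :: 'b measure). f z = g z"
    using fg unfolding lborel_prod .
  then have sections: "AE x in lborel. AE y in lborel. f (x, y) = g (x, y)"
    by (rule lborel_pair.AE_pair)
  have inner: "AE x in lborel. (LINT y|lebesgue. f (x, y)) = (LINT y|lborel. g (x, y))"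
    using sections
  proof eventually_elim
    case (elim x)
    have gx: "(\<lambda>y. g (x, y)) \<in> borel_measurable lborel"
      using g by measurable
    then have gx': "(\<lambda>y. g (x, y)) \<in> borel_measurable lebesgue" by (rule measurable_completion)
    have eq: "AE y in lebesgue. g (x, y) = f (x, y)"
      using AE_completion[OF elim] by (auto elim: eventually_mono)
    have "(LINT y|lebesgue. f (x, y)) = (LINT y|lebesgue. g (x, y))"
      by (intro integral_cong_AE borel_measurable_AE[OF gx' eq] gx') (use eq in auto)
    also have "\<dots> = (LINT y|lborel. g (x, y))" by (rule integral_completion[OF gx])
    finally show ?case .
  qed
  have "g \<in> borel_measurable (lborel \<Otimes>\<^sub>M lborel)" using gint by auto
  then have G: "(\<lambda>x. LINT y|lborel. g (x, y)) \<in> borel_measurable lborel"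
    by (intro lborel.borel_measurable_lebesgue_integral) simp
  then have G': "(\<lambda>x. LINT y|lborel. g (x, y)) \<in> borel_measurable lebesgue"
    by (rule measurable_completion)
  have eq: "AE x in lebesgue. (LINT y|lborel. g (x, y)) = (LINT y|lebesgue. f (x, y))"
    using AE_completion[OF inner] by (auto elim: eventually_mono)
  have "(LINT x|lebesgue. LINT y|lebesgue. f (x, y)) = (LINT x|lebesgue. LINT y|lborel. g (x, y))"
    by (intro integral_cong_AE borel_measurable_AE[OF G' eq] G') (use eq in auto)
  also have "\<dots> = (LINT x|lborel. LINT y|lborel. g (x, y))" by (rule integral_completion[OF G])
  also have "\<dots> = integral\<^sup>L (lborel \<Otimes>\<^sub>M lborel) g" by (rule lborel_pair.integral_fst'[OF gint])
  also have "\<dots> = integral\<^sup>L lborel g" by (simp add: lborel_prod)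
  also have "\<dots> = integral\<^sup>L lebesgue g" by (rule integral_completion[OF g, symmetric])
  also have "\<dots> = integral\<^sup>L lebesgue f"
    by (intro integral_cong_AE gl borel_measurable_integrable[OF f])
      (use AE_completion[OF fg] in \<open>auto elim: eventually_mono\<close>)
  finally show ?thesis .
qed

lemma lebesgue_on_Fubini:
  fixes f :: "'a::euclidean_space \<times> 'b::euclidean_space \<Rightarrow> real"
  assumes A: "A \<in> sets borel" and B: "B \<in> sets borel"
    and f: "integrable (lebesgue_on (A \<times> B)) f"
  shows "(LINT x|lebesgue_on A. LINT y|lebesgue_on B. f (x, y)) = integral\<^sup>L (lebesgue_on (A \<times> B)) f"
proof -
  have "A \<times> B \<in> sets (borel :: ('a \<times> 'b) measure)" using A B by (rule borel_Times)
  then have [simp]: "A \<times> B \<in> sets lebesgue" by simp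
  have [simp]: "A \<in> sets lebesgue" "B \<in> sets lebesgue" using A B by auto
  have "integrable lebesgue (\<lambda>z. indicator (A \<times> B) z * f z)"
    using f by (simp add: integrable_restrict_space)
  from lebesgue_Fubini[OF this] show ?thesis
    by (simp add: integral_restrict_space indicator_times mult.assoc)
qed

text \<open>
  At points where \<open>u < 1\<close> the pressure is 0, so the bound of the pressure by \<open>M\<close> relies on
  \<open>0 \<le> M\<close>.  The null measure is a separate case: the essential supremum of every measurable function is
  then \<open>-\<infinity>\<close>, which \<^const>\<open>real_of_ereal\<close> sends to 0.
\<close>

lemma Linf_norm_nonneg: "0 \<le> Linf_norm N f"
proof (cases "emeasure N (space N) = 0")
  case True
  then show ?thesis
    by (cases "(\<lambda>x. ereal \<bar>f x\<bar>) \<in> borel_measurable N")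
      (simp_all add: Linf_norm_def esssup_zero_space esssup_non_measurable top_ereal_def)
next
  case False
  then have "(0::ereal) = esssup N (\<lambda>x. 0)" by (rule esssup_const[symmetric])
  also have "\<dots> \<le> esssup N (\<lambda>x. ereal \<bar>f x\<bar>)" by (rule esssup_mono) auto
  finally show ?thesis by (simp add: Linf_norm_def real_of_ereal_pos)
qed

lemma pressure_nonneg: "0 \<le> \<mu> \<Longrightarrow> 0 \<le> pressure \<mu> u z"
  by (simp add: pressure_def)

lemma pressure_le:
  assumes "0 < \<mu>" "0 \<le> M" "u z \<le> 1 + M / \<mu>"
  shows "pressure \<mu> u z \<le> M"
proof -
  have "max (u z - 1) 0 \<le> M / \<mu>" using assms by simp
  then have "\<mu> * max (u z - 1) 0 \<le> \<mu> * (M / \<mu>)"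
    using assms(1) by (intro mult_left_mono) auto
  then show ?thesis using assms(1) by (simp add: pressure_def)
qed

text \<open>
  The equation in the weak identity with its space-time terms as joint integrals, the form to which
  weak-\<open>*\<close> convergence applies.  Boundedness makes both products integrable, as Fubini's theorem
  and the first two conjuncts of \<^const>\<open>weak_identity\<close> require.
\<close>

lemma weak_identity_iff_joint_integrals:
  assumes D: "open D" and \<phi>: "test_function D \<nu> p u_I \<phi>"
    and u: "Linf (spacetime D) u" and w: "Linf (spacetime D) w"
  shows "weak_identity D \<nu> p u_I \<phi> u w \<longleftrightarrow>
    (LINT z|spacetime D. u z * t_deriv \<phi> z) + (LINT z|spacetime D. w z * x_laplacian \<phi> z) =
    (LINT x|boundary_measure D. LINT t|lebesgue_on {0<..}. normal_deriv \<nu> \<phi> (x, t) * p x) -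
    (LINT x|lebesgue_on (- D). \<phi> (x, 0) * u_I x)"
proof -
  have int: "integrable (spacetime D) (\<lambda>z. t_deriv \<phi> z * u z)"
    "integrable (spacetime D) (\<lambda>z. x_laplacian \<phi> z * w z)"
    using \<phi> integrable_mult_Linf[OF u, of "t_deriv \<phi>"]
      integrable_mult_Linf[OF w, of "x_laplacian \<phi>"]
    unfolding test_function_def
    by (simp_all add: mult.commute[of "t_deriv \<phi> _"] mult.commute[of "x_laplacian \<phi> _"])
  have sets: "- D \<in> sets borel" "{0<..} \<in> sets (borel :: real measure)"
    using D by auto
  show ?thesis
    using int lebesgue_on_Fubini[OF sets int(1)] lebesgue_on_Fubini[OF sets int(2)]
    by (simp add: weak_identity_def mult.commute)
qed

theorem lemma2p5:
  fixes D :: "'a::euclidean_space set"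
    and \<alpha> :: real
    and p u_I :: "'a \<Rightarrow> real"
    and \<nu> :: "'a \<Rightarrow> 'a"
    and u :: "real \<Rightarrow> 'a \<times> real \<Rightarrow> real"
    and m :: "nat \<Rightarrow> real"
    and u_inf V :: "'a \<times> real \<Rightarrow> real"
  assumes "bounded D" and "open D"
    and "0 < \<alpha>" and "\<alpha> < 1" and "C2_holder_boundary \<alpha> D"
    and normal: "\<And>x. x \<in> frontier D \<Longrightarrow> exterior_unit_normal (- D) x (\<nu> x)"
    and u_I: "u_I \<in> borel_measurable (lebesgue_on (- D))"
      "\<And>x. x \<notin> D \<Longrightarrow> 0 \<le> u_I x \<and> u_I x \<le> 1"
      "compact (closure {x. x \<notin> D \<and> u_I x \<noteq> 0})"
    and p: "C2_holder_on_boundary \<alpha> D p" "\<And>x. x \<in> frontier D \<Longrightarrow> 0 < p x"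
    and solution: "\<And>\<mu>. 0 < \<mu> \<Longrightarrow> weak_solution D \<nu> p u_I \<mu> (u \<mu>)"
    and a_priori: "\<And>\<mu>. 0 < \<mu> \<Longrightarrow>
      AE z in spacetime D. 0 \<le> u \<mu> z \<and> u \<mu> z \<le> 1 + Linf_norm (boundary_measure D) p / \<mu>"
    and m: "\<And>j. 0 < m j" "filterlim m at_top sequentially"
    and limits: "weak_star_tendsto (spacetime D) (\<lambda>j. u (m j)) u_inf"
      "weak_star_tendsto (spacetime D) (\<lambda>j. pressure (m j) (u (m j))) V"
  shows "(AE z in spacetime D. 0 \<le> V z \<and> V z \<le> Linf_norm (boundary_measure D) p) \<and>
    (\<forall>\<phi>. test_function D \<nu> p u_I \<phi> \<longrightarrow> weak_identity D \<nu> p u_I \<phi> u_inf V)"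
proof (intro conjI allI impI)
  let ?N = "spacetime D" and ?M = "Linf_norm (boundary_measure D) p"
  have "(- D) \<times> {0::real<..} \<in> sets borel" using \<open>open D\<close> by (intro borel_Times) auto
  then have "(- D) \<times> {0::real<..} \<in> sets lebesgue" by simp
  then have sf: "sigma_finite_measure ?N" by (rule sigma_finite_lebesgue_on)
  have "AE z in ?N. 0 \<le> V z"
    by (rule weak_star_limit_AE_ge[OF sf limits(2)])
      (simp add: pressure_nonneg less_imp_le[OF m(1)])
  moreover have "AE z in ?N. V z \<le> ?M"
  proof (rule weak_star_limit_AE_le[OF sf limits(2)])
    show "AE z in ?N. pressure (m j) (u (m j)) z \<le> ?M" for j
      using a_priori[OF m(1)[of j]]
      by eventually_elim (simp add: pressure_le m(1) Linf_norm_nonneg)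
  qed
  ultimately show "AE z in ?N. 0 \<le> V z \<and> V z \<le> ?M" by auto
next
  fix \<phi> assume \<phi>: "test_function D \<nu> p u_I \<phi>"
  let ?N = "spacetime D"
  let ?L = "\<lambda>u w. (LINT z|?N. u z * t_deriv \<phi> z) + (LINT z|?N. w z * x_laplacian \<phi> z)"
  let ?R = "(LINT x|boundary_measure D. LINT t|lebesgue_on {0<..}. normal_deriv \<nu> \<phi> (x, t) * p x) -
    (LINT x|lebesgue_on (- D). \<phi> (x, 0) * u_I x)"
  note joint = weak_identity_iff_joint_integrals[OF \<open>open D\<close> \<phi>]
  have "?L (u (m j)) (pressure (m j) (u (m j))) = ?R" for j
    using solution[OF m(1)[of j]] \<phi> limits
    by (subst joint[symmetric]) (simp_all add: weak_solution_def weak_star_tendsto_def)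
  moreover have "(\<lambda>j. ?L (u (m j)) (pressure (m j) (u (m j)))) \<longlonglongrightarrow> ?L u_inf V"
    using limits \<phi> by (intro tendsto_add) (simp_all add: weak_star_tendsto_def test_function_def)
  ultimately have "?L u_inf V = ?R"
    by (simp add: LIMSEQ_const_iff)
  then show "weak_identity D \<nu> p u_I \<phi> u_inf V"
    using limits by (subst joint) (simp_all add: weak_star_tendsto_def)
qed

end
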